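(* There are absolute constants $C,c>0$ such that the following holds. Let $G$ be a finite abelian group of order $n$ and let $\alpha\in(0,1)$. There exist collections $\mathcal{F}_\ell$ ($\ell=0,1,2,\dots$) of subsets of $G$ with \[|\mathcal{F}_\ell|\le\exp\left(C2^{2\ell}(\log n)^2\right)\quad\text{and}\quad\min_{F\in\mathcal{F}_\ell}|F|\ge c\,2^{\ell}\alpha n/\max(1,\ell)^2,\] such that: for every $K\ge 1$ and every $A\subseteq G$ with $|A-A|\le K|A|$ and $|A|=\alpha n$, letting $\ell=\ell(A)$ be the smallest integer $0\le\ell\le\log_2K$ with $|A_\ell|\ge c\,2^{\ell}\alpha n/\max(1,\ell)^2$ (such an integer exists), there is $F\in\mathcal{F}_\ell$ with $A-A\supseteq F\supseteq A_\ell$.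
   Context: A set $A$ is identified with its indicator function, $-A=\{-a:a\in A\}$, $A-A=\{a-b:a,b\in A\}$, and $f*g(x)=\frac1n\sum_{y\in G}f(y)g(x-y)$, so $A*(-A)(x)=|A\cap(A+x)|/n$. For an integer $\ell\ge0$, $A_\ell=\{x\in G: A*(-A)(x)\in(2^{-\ell-1}\alpha,\,2^{-\ell}\alpha]\}$.
   Formalization: The range 0≤ℓ≤log₂K is replaced by 0≤ℓ≤⌈log₂K⌉, since a large level ℓ≤log₂K need not exist (e.g. A the 2^m unit vectors of (Z/3)^{2^m}); the groups G range over one carrier type, which, taken as the natural numbers, covers all finite abelian groups up to isomorphism. *)

theory Defs
  imports Complex_Main "HOL-Algebra.Coset" "HOL-Library.Indicator_Function"
begin

text \<open>
  Groups are written multiplicatively: \<open>x - y\<close> is \<open>x \<otimes> inv y\<close>, \<open>-A\<close> is \<open>set_inv A\<close> and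
  \<open>A - A\<close> is \<open>A <#> set_inv A\<close>.
\<close>

definition convolution :: "('a, 'b) monoid_scheme \<Rightarrow> ('a \<Rightarrow> real) \<Rightarrow> ('a \<Rightarrow> real) \<Rightarrow> 'a \<Rightarrow> real"
  where "convolution G f g x =
    (1 / real (order G)) * (\<Sum>y\<in>carrier G. f y * g (x \<otimes>\<^bsub>G\<^esub> inv\<^bsub>G\<^esub> y))"

definition diff_set :: "('a, 'b) monoid_scheme \<Rightarrow> 'a set \<Rightarrow> 'a set"
  where "diff_set G A = A <#>\<^bsub>G\<^esub> set_inv\<^bsub>G\<^esub> A"

definition level_set :: "('a, 'b) monoid_scheme \<Rightarrow> real \<Rightarrow> 'a set \<Rightarrow> nat \<Rightarrow> 'a set"
  where "level_set G \<alpha> A l =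
    {x \<in> carrier G. convolution G (indicator A) (indicator (set_inv\<^bsub>G\<^esub> A)) x
       \<in> {\<alpha> / 2 ^ (l + 1) <.. \<alpha> / 2 ^ l}}"

text \<open>
  Pitfall: a level \<open>l \<le> log 2 K\<close> with \<open>card (level_set G \<alpha> A l)\<close> at least
  \<open>c * 2 ^ l * \<alpha> * n / (max 1 l)\<^sup>2\<close> need not exist; only \<open>l \<le> \<lceil>log 2 K\<rceil>\<close> can be guaranteed.
  If \<open>A\<close> is a Sidon set of size \<open>k = 2 ^ m\<close> (e.g. the unit vectors of \<open>(Z/3)^k\<close>), then
  \<open>|A - A| = k\<^sup>2 - k + 1\<close>, so \<open>K = k - 1 + 1/k < 2 ^ m\<close> is admissible, while every nonzero
  difference lies in level \<open>m\<close>. Level 0 is then \<open>{0}\<close> and the levels strictly between 0 and \<open>m\<close>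
  are empty, so for \<open>k > 1/c\<close> no level up to \<open>log 2 K\<close> is large.
\<close>

end

theory Submission
  imports Defs "HOL-Algebra.Multiplicative_Group"
begin

text \<open>
  The normalised autocorrelation \<open>|A \<inter> (A + x)| / |A|\<close> is a convex combination of the \<open>n\<close>
  characters of \<open>G\<close>, with weights proportional to the squared Fourier coefficients of \<open>A\<close>.
  Sampling \<open>O(4^l log n)\<close> characters from these weights approximates it at all points within
  \<open>2^{-l-2}\<close>. Thresholding the sample mean at \<open>2^{-l-2}\<close> then gives a set between the \<open>l\<close>-th
  level set and \<open>A - A\<close>, and there are only \<open>n^{O(4^l log n)}\<close> possible samples. That some level
  is popular follows by pigeonhole: the points with correlation at most \<open>1 / (2 K)\<close> contribute at most
  half of the total mass \<open>|A|\<^sup>2\<close>, and \<open>\<Sum> 1 / l\<^sup>2\<close> converges.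
\<close>

section \<open>Random sampling by potential descent\<close>

text \<open>Bounds the moment generating function of a bounded variable; averaging removes the
  linear term when the mean is 0. For \<open>t = - s\<close> with \<open>0 < s\<close>, the reason
  is the factorisation 1 + s^3 = (1 - s + s^2)(1 + s) together with 1 + s \<le> exp s.\<close>

lemma exp_le_quadratic:
  fixes t :: real
  assumes "\<bar>t\<bar> \<le> 1"
  shows "exp t \<le> 1 + t + t\<^sup>2"
proof (cases "t \<ge> 0")
  case True
  then show ?thesis
    using assms exp_bound by auto
next
  case False
  define s where "s = - t"
  have s: "0 < s" "s \<le> 1"
    using False assms by (auto simp: s_def)
  have "1 \<le> 1 + s ^ 3"
    using s by simp
  also have "\<dots> = (1 - s + s\<^sup>2) * (1 + s)"
    by (simp add: algebra_simps power2_eq_square power3_eq_cube)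
  also have "\<dots> \<le> (1 - s + s\<^sup>2) * exp s"
    using s by (intro mult_left_mono exp_ge_add_one_self) auto
  finally have "exp (- s) \<le> 1 - s + s\<^sup>2"
    by (simp add: exp_minus field_simps)
  then show ?thesis
    by (simp add: s_def)
qed

text \<open>First-moment method: not every value can exceed the average. It replaces all
  probabilistic choices below.\<close>

lemma weighted_average_attained:
  fixes p g :: "'c \<Rightarrow> real"
  assumes "\<And>c. c \<in> \<Gamma> \<Longrightarrow> 0 \<le> p c" and "sum p \<Gamma> = 1"
    and "(\<Sum>c\<in>\<Gamma>. p c * g c) \<le> B"
  shows "\<exists>c\<in>\<Gamma>. g c \<le> B"
proof (rule ccontr)
  assume "\<not> ?thesis"
  then have less: "B < g c" if "c \<in> \<Gamma>" for c
    using that by force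
  \<comment> \<open>A sum over an infinite set is 0 by convention, so total weight 1 forces
    finiteness.\<close>
  have fin: "finite \<Gamma>"
    using assms(2) by (metis sum.infinite zero_neq_one)
  have "\<exists>c\<in>\<Gamma>. p c \<noteq> 0"
    using assms(2) by (metis sum.neutral zero_neq_one)
  then obtain c where c: "c \<in> \<Gamma>" "p c > 0"
    using assms(1) by (metis order_le_less)
  have "(\<Sum>c\<in>\<Gamma>. p c * B) < (\<Sum>c\<in>\<Gamma>. p c * g c)"
  proof (rule sum_strict_mono_ex1[OF fin])
    show "\<forall>c\<in>\<Gamma>. p c * B \<le> p c * g c"
      using less assms(1) by (simp add: mult_left_mono less_imp_le)
    show "\<exists>c\<in>\<Gamma>. p c * B < p c * g c"
      using less c by (intro bexI[of _ c]) auto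
  qed
  then show False
    using assms(2,3) by (simp flip: sum_distrib_right)
qed

text \<open>A Chernoff bound by the method of conditional expectations. Drawing one more entry from
  \<open>p\<close> multiplies the expected potential by at most exp(4 t^2), so some concrete entry
  does at least as well.\<close>

lemma exists_sample_small_potential:
  fixes p :: "'c \<Rightarrow> real" and f :: "'x \<Rightarrow> 'c \<Rightarrow> real"
  assumes p_nonneg: "\<And>c. c \<in> \<Gamma> \<Longrightarrow> 0 \<le> p c" and p_sum: "sum p \<Gamma> = 1"
    and bound: "\<And>x c. x \<in> X \<Longrightarrow> c \<in> \<Gamma> \<Longrightarrow> \<bar>f x c\<bar> \<le> 2"
    and mean: "\<And>x. x \<in> X \<Longrightarrow> (\<Sum>c\<in>\<Gamma>. p c * f x c) = 0"
    and t: "0 \<le> t" "t \<le> 1 / 2"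
  shows "\<exists>cs. set cs \<subseteq> \<Gamma> \<and> length cs = m \<and>
    (\<Sum>x\<in>X. exp (t * (\<Sum>c\<leftarrow>cs. f x c))) \<le> real (card X) * exp (4 * t\<^sup>2 * real m)"
proof (induction m)
  case 0
  show ?case by simp
next
  case (Suc m)
  then obtain cs where cs: "set cs \<subseteq> \<Gamma>" "length cs = m"
    and IH: "(\<Sum>x\<in>X. exp (t * (\<Sum>c\<leftarrow>cs. f x c))) \<le> real (card X) * exp (4 * t\<^sup>2 * real m)"
    by blast
  define E where "E x = exp (t * (\<Sum>c\<leftarrow>cs. f x c))" for x
  have step: "(\<Sum>c\<in>\<Gamma>. p c * exp (t * f x c)) \<le> exp (4 * t\<^sup>2)" if x: "x \<in> X" for x
  proof -
    \<comment> \<open>Since |f| \<le> 2, the bound t \<le> 1/2 gives |t f| \<le> 1, and (t f)^2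
      \<le> 4 t^2.\<close>
    have "exp (t * f x c) \<le> 1 + t * f x c + 4 * t\<^sup>2" if c: "c \<in> \<Gamma>" for c
    proof -
      have "\<bar>t * f x c\<bar> \<le> t * 2"
        unfolding abs_mult using t bound[OF x c] by (intro mult_mono) auto
      then have "\<bar>t * f x c\<bar> \<le> 1" "(t * f x c)\<^sup>2 \<le> (t * 2)\<^sup>2"
        using t by (linarith, intro abs_le_square_iff[THEN iffD1], auto)
      then show ?thesis
        using exp_le_quadratic[of "t * f x c"] by (simp add: power_mult_distrib)
    qed
    then have "(\<Sum>c\<in>\<Gamma>. p c * exp (t * f x c)) \<le> (\<Sum>c\<in>\<Gamma>. p c * (1 + t * f x c + 4 * t\<^sup>2))"
      by (intro sum_mono mult_left_mono p_nonneg)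
    also have "\<dots> = sum p \<Gamma> + t * (\<Sum>c\<in>\<Gamma>. p c * f x c) + 4 * t\<^sup>2 * sum p \<Gamma>"
      by (simp only: sum_distrib_left flip: sum.distrib) (simp add: algebra_simps)
    also have "\<dots> \<le> exp (4 * t\<^sup>2)"
      using mean[OF x] p_sum exp_ge_add_one_self[of "4 * t\<^sup>2"] by simp
    finally show ?thesis .
  qed
  have "(\<Sum>c\<in>\<Gamma>. p c * (\<Sum>x\<in>X. E x * exp (t * f x c)))
      = (\<Sum>x\<in>X. E x * (\<Sum>c\<in>\<Gamma>. p c * exp (t * f x c)))"
    unfolding sum_distrib_left by (subst sum.swap) (simp add: mult_ac)
  also have "\<dots> \<le> (\<Sum>x\<in>X. E x * exp (4 * t\<^sup>2))"
    using step by (intro sum_mono mult_left_mono) (auto simp: E_def)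
  also have "\<dots> \<le> real (card X) * exp (4 * t\<^sup>2 * real m) * exp (4 * t\<^sup>2)"
    using IH by (simp add: E_def flip: sum_distrib_right)
  also have "\<dots> = real (card X) * exp (4 * t\<^sup>2 * real (Suc m))"
    by (simp add: algebra_simps exp_add)
  finally have "\<exists>c\<in>\<Gamma>. (\<Sum>x\<in>X. E x * exp (t * f x c)) \<le> real (card X) * exp (4 * t\<^sup>2 * real (Suc m))"
    by (intro weighted_average_attained[where p = p] p_nonneg p_sum)
  then obtain c where c: "c \<in> \<Gamma>"
    "(\<Sum>x\<in>X. E x * exp (t * f x c)) \<le> real (card X) * exp (4 * t\<^sup>2 * real (Suc m))"
    by blast
  have "E x * exp (t * f x c) = exp (t * (\<Sum>c\<leftarrow>c # cs. f x c))" for x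
    by (simp add: E_def algebra_simps exp_add)
  then show ?case
    using c cs by (intro exI[of _ "c # cs"]) auto
qed

text \<open>A single large deviation would make its own exponential exceed the whole potential. The
  strict bound on \<open>m\<close> is what remains after optimising \<open>t\<close>. Only upper
  deviations are controlled; a sign inside \<open>f\<close> selects the direction.\<close>

lemma exists_sample_deviation_less:
  fixes p :: "'c \<Rightarrow> real" and f :: "'x \<Rightarrow> 'c \<Rightarrow> real"
  assumes "\<And>c. c \<in> \<Gamma> \<Longrightarrow> 0 \<le> p c" and "sum p \<Gamma> = 1" and X: "finite X"
    and "\<And>x c. x \<in> X \<Longrightarrow> c \<in> \<Gamma> \<Longrightarrow> \<bar>f x c\<bar> \<le> 2"
    and "\<And>x. x \<in> X \<Longrightarrow> (\<Sum>c\<in>\<Gamma>. p c * f x c) = 0"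
    and e: "0 < e" "e \<le> 4" and m: "16 * ln (real (card X)) < e\<^sup>2 * real m"
  obtains cs where "set cs \<subseteq> \<Gamma>" "length cs = m"
    and "\<And>x. x \<in> X \<Longrightarrow> (\<Sum>c\<leftarrow>cs. f x c) < e * real m"
proof -
  \<comment> \<open>The choice t = e/8 maximises t e - 4 t^2, with maximum e^2/16; this is the
    source of the 16 in the hypothesis on \<open>m\<close>.\<close>
  have "0 \<le> e / 8" "e / 8 \<le> 1 / 2"
    using e by auto
  from exists_sample_small_potential[where f = f and p = p and \<Gamma> = \<Gamma> and X = X and m = m,
      OF assms(1,2,4,5) this]
  obtain cs where cs: "set cs \<subseteq> \<Gamma>" "length cs = m"
    and pot: "(\<Sum>x\<in>X. exp (e / 8 * (\<Sum>c\<leftarrow>cs. f x c)))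
      \<le> real (card X) * exp (4 * (e / 8)\<^sup>2 * real m)"
    by auto
  have "(\<Sum>c\<leftarrow>cs. f x c) < e * real m" if x: "x \<in> X" for x
  proof (rule ccontr)
    assume "\<not> ?thesis"
    then have "exp (e / 8 * (e * real m)) \<le> exp (e / 8 * (\<Sum>c\<leftarrow>cs. f x c))"
      using e by simp
    also have "\<dots> \<le> (\<Sum>x\<in>X. exp (e / 8 * (\<Sum>c\<leftarrow>cs. f x c)))"
      using X x by (intro member_le_sum) auto
    also note pot
    also have "real (card X) * exp (4 * (e / 8)\<^sup>2 * real m)
        = exp (ln (real (card X)) + 4 * (e / 8)\<^sup>2 * real m)"
      using X x by (subst exp_add, subst exp_ln) (auto simp: card_gt_0_iff)
    finally have "e / 8 * (e * real m) \<le> ln (real (card X)) + 4 * (e / 8)\<^sup>2 * real m"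
      by simp
    then show False
      using m by (simp add: power2_eq_square field_simps)
  qed
  with cs show thesis
    by (rule that)
qed

section \<open>Characters of a finite abelian group\<close>

text \<open>Values outside \<open>H\<close> are unconstrained. The value 1 at the identity excludes
  the zero function; in a finite group all values on a subgroup are then roots of unity.\<close>

definition character_on :: "('a, 'b) monoid_scheme \<Rightarrow> 'a set \<Rightarrow> ('a \<Rightarrow> complex) \<Rightarrow> bool"
  where "character_on G H \<chi> \<longleftrightarrow>
    \<chi> \<one>\<^bsub>G\<^esub> = 1 \<and> (\<forall>x\<in>H. \<forall>y\<in>H. \<chi> (x \<otimes>\<^bsub>G\<^esub> y) = \<chi> x * \<chi> y)"

text \<open>Extensionality makes a character determined by its values on the group, so that counting
  and summing over this set are meaningful.\<close>

definition characters :: "('a, 'b) monoid_scheme \<Rightarrow> ('a \<Rightarrow> complex) set"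
  where "characters G = {\<chi> \<in> extensional (carrier G). character_on G (carrier G) \<chi>}"

lemma complex_root_exists:
  assumes "k > 0"
  obtains w :: complex where "w ^ k = z"
proof -
  have "rcis (root k (cmod z)) (Arg z / real k) ^ k = z"
    using assms by (simp add: DeMoivre2 rcis_cmod_Arg)
  then show thesis
    by (rule that)
qed

lemma nontrivial_root_of_unity_exists:
  assumes "k \<ge> 2"
  obtains w :: complex where "w ^ k = 1" "w \<noteq> 1"
proof -
  have "card {z :: complex. z ^ k = 1} = k"
    using assms by (intro card_roots_unity_eq) auto
  then have "\<not> {z :: complex. z ^ k = 1} \<subseteq> {1}"
    using assms card_mono[of "{1 :: complex}" "{z. z ^ k = 1}"] by auto
  then show thesis
    using that by blast
qed

context comm_group
begin

section \<open>Extending characters from a subgroup\<close>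

lemma character_on_pow:
  assumes "character_on G H \<chi>" "subgroup H G" "h \<in> H"
  shows "\<chi> (h [^] (i :: nat)) = \<chi> h ^ i"
proof (induction i)
  case (Suc i)
  have "h [^] i \<in> H"
    using assms(2,3) by (induction i) (auto simp: subgroup.one_closed subgroup.m_closed)
  then show ?case
    using Suc assms by (simp add: character_on_def)
qed (use assms in \<open>simp add: character_on_def\<close>)

text \<open>With \<open>k\<close> the order of \<open>g\<close> modulo \<open>H\<close>, the map h
  g^i \<mapsto> \<chi>(h) w^i is well defined on the subgroup generated by \<open>H\<close> and
  \<open>g\<close> for each \<open>k\<close>-th root \<open>w\<close> of \<chi>(g^k). The freedom in
  \<open>w\<close> matters: any root serves for extension, while separating points needs a root
  other than 1.\<close>

lemma extend_character_by_one:
  assumes fin: "finite (carrier G)" and H: "subgroup H G" and \<chi>: "character_on G H \<chi>"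
    and g: "g \<in> carrier G" "g \<notin> H"
  obtains k where "k \<ge> 2" "g [^] k \<in> H"
    and "\<And>w. w ^ k = \<chi> (g [^] k) \<Longrightarrow> \<exists>H' \<chi>'. subgroup H' G \<and> H \<subset> H' \<and> g \<in> H' \<and>
      character_on G H' \<chi>' \<and> (\<forall>h\<in>H. \<chi>' h = \<chi> h) \<and> \<chi>' g = w"
proof -
  interpret H: subgroup H G by (rule H)
  define k where "k = (LEAST k :: nat. k > 0 \<and> g [^] k \<in> H)"
  \<comment> \<open>The group order is a candidate exponent, so the least one exists.\<close>
  have "order G > 0 \<and> g [^] order G \<in> H"
    using fin g by (simp add: pow_order_eq_1 order_gt_0_iff_finite)
  then have "k > 0 \<and> g [^] k \<in> H"
    unfolding k_def by (rule LeastI)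
  then have k: "k > 0" "g [^] k \<in> H"
    by auto
  have least: "i \<ge> k" if "i > 0" "g [^] i \<in> H" for i :: nat
    unfolding k_def using that by (intro Least_le) auto
  have "k \<noteq> 1"
    using k g by auto
  then have k2: "k \<ge> 2"
    using k by simp
  have "(g [^] k) [^] q \<in> H" for q :: nat
    using k by (induction q) auto
  then have pow_in_H: "g [^] (k * q) \<in> H" for q
    using g by (simp add: nat_pow_pow)
  \<comment> \<open>Division with remainder: the remainder is again such an exponent, hence 0 by
    minimality of \<open>k\<close>.\<close>
  have dvd: "k dvd i" if "g [^] i \<in> H" for i :: nat
  proof -
    have "g [^] i = g [^] (k * (i div k)) \<otimes> g [^] (i mod k)"
      using g by (simp add: nat_pow_mult)
    then have "g [^] (i mod k) = inv (g [^] (k * (i div k))) \<otimes> g [^] i"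
      using g by (simp flip: m_assoc)
    then have "g [^] (i mod k) \<in> H"
      using that pow_in_H by simp
    then have "i mod k = 0"
      using least[of "i mod k"] k by (metis gr0I mod_less_divisor not_le)
    then show ?thesis by auto
  qed
  have "\<exists>H' \<chi>'. subgroup H' G \<and> H \<subset> H' \<and> g \<in> H' \<and>
      character_on G H' \<chi>' \<and> (\<forall>h\<in>H. \<chi>' h = \<chi> h) \<and> \<chi>' g = w"
    if w: "w ^ k = \<chi> (g [^] k)" for w
  proof -
    \<comment> \<open>Natural exponents suffice because \<open>g\<close> has finite order.\<close>
    define H' where "H' = {h \<otimes> g [^] i | h i :: nat. h \<in> H}"
    have \<chi>_pow: "\<chi> (g [^] i) = w ^ i" if i: "g [^] i \<in> H" for i :: nat
    proof -
      obtain q where q: "i = k * q"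
        using dvd[OF i] by auto
      have "\<chi> (g [^] i) = \<chi> ((g [^] k) [^] q)"
        using g by (simp add: q nat_pow_pow)
      then show ?thesis
        using character_on_pow[OF \<chi> H k(2)] by (simp add: q w power_mult)
    qed
    \<comment> \<open>Ordering the exponents avoids negative powers: cancelling g^i puts g^(j - i)
      in \<open>H\<close>, where \<open>\<chi>\<close> is already known to equal w^(j - i).\<close>
    have wd_le: "\<chi> h * w ^ i = \<chi> h' * w ^ j"
      if "h \<in> H" "h' \<in> H" "h \<otimes> g [^] i = h' \<otimes> g [^] j" "i \<le> j" for h h' and i j :: nat
    proof -
      have "h \<otimes> g [^] i = (h' \<otimes> g [^] (j - i)) \<otimes> g [^] i"
        using that g by (simp add: m_assoc nat_pow_mult)
      then have eq: "h = h' \<otimes> g [^] (j - i)"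
        using that g by (simp add: H.mem_carrier)
      then have "g [^] (j - i) = inv h' \<otimes> h"
        using that g by (simp add: inv_solve_left H.mem_carrier)
      then have *: "g [^] (j - i) \<in> H"
        using that by simp
      have "\<chi> h = \<chi> h' * w ^ (j - i)"
        using \<chi> * that(2) \<chi>_pow[OF *] by (simp add: eq character_on_def)
      then show ?thesis
        using that(4) by (simp flip: power_add)
    qed
    have wd: "\<chi> h * w ^ i = \<chi> h' * w ^ j"
      if "h \<in> H" "h' \<in> H" "h \<otimes> g [^] i = h' \<otimes> g [^] j" for h h' and i j :: nat
      using wd_le[of h h' i j] wd_le[of h' h j i] that by (cases "i \<le> j") auto
    define \<chi>' where
      "\<chi>' y = (THE v. \<exists>h (i :: nat). h \<in> H \<and> y = h \<otimes> g [^] i \<and> v = \<chi> h * w ^ i)" for y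
    have \<chi>': "\<chi>' (h \<otimes> g [^] i) = \<chi> h * w ^ i" if "h \<in> H" for h and i :: nat
      unfolding \<chi>'_def
    proof (rule the_equality)
      show "\<exists>h' (j :: nat). h' \<in> H \<and> h \<otimes> g [^] i = h' \<otimes> g [^] j \<and> \<chi> h * w ^ i = \<chi> h' * w ^ j"
        using that by blast
    qed (use that wd in metis)
    have mult: "(h \<otimes> g [^] i) \<otimes> (h' \<otimes> g [^] j) = (h \<otimes> h') \<otimes> g [^] (i + j)"
      if "h \<in> H" "h' \<in> H" for h h' and i j :: nat
    proof -
      have c: "h \<in> carrier G" "h' \<in> carrier G" "g [^] i \<in> carrier G" "g [^] j \<in> carrier G"
        using that g by (auto simp: H.mem_carrier)
      have "(h \<otimes> g [^] i) \<otimes> (h' \<otimes> g [^] j) = (h \<otimes> h') \<otimes> (g [^] i \<otimes> g [^] j)"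
        using c by (simp add: m_ac)
      then show ?thesis
        using g by (simp add: nat_pow_mult)
    qed
    have \<chi>'_H: "\<chi>' h = \<chi> h" if "h \<in> H" for h
      using \<chi>'[OF that, of 0] that by (simp add: H.mem_carrier)
    have \<chi>'_g: "\<chi>' g = w"
      using \<chi>'[OF H.one_closed, of 1] \<chi> g by (simp add: character_on_def)
    have HH': "H \<subseteq> H'"
    proof
      fix h assume "h \<in> H"
      then show "h \<in> H'"
        unfolding H'_def by (auto intro!: exI[of _ h] exI[of _ "0 :: nat"] simp: H.mem_carrier)
    qed
    have gH': "g \<in> H'"
      unfolding H'_def using g by (auto intro!: exI[of _ "\<one>"] exI[of _ "1 :: nat"])
    have "subgroup H' G"
    proof (rule subgroupI)
      show "H' \<subseteq> carrier G"
        unfolding H'_def using g by (auto simp: H.mem_carrier)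
      show "H' \<noteq> {}"
        using gH' by auto
      show "x \<otimes> y \<in> H'" if "x \<in> H'" "y \<in> H'" for x y
        using that mult unfolding H'_def by blast
      show "inv x \<in> H'" if x_in: "x \<in> H'" for x
      proof -
        obtain h and i :: nat where x: "x = h \<otimes> g [^] i" and h: "h \<in> H"
          using x_in unfolding H'_def by auto
        \<comment> \<open>The inverse of g^i is g^(i (|G| - 1)), again a natural power.\<close>
        have "x \<otimes> (inv h \<otimes> g [^] (i * (order G - 1))) = g [^] (i + i * (order G - 1))"
          unfolding x using h g by (simp add: mult)
        also have "i + i * (order G - 1) = order G * i"
          using \<open>order G > 0 \<and> _\<close> by (cases "order G") auto
        also have "g [^] (order G * i) = (g [^] order G) [^] i"
          using g by (simp add: nat_pow_pow)
        also have "\<dots> = \<one>"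
          using g by (simp add: pow_order_eq_1)
        finally have "inv x = inv h \<otimes> g [^] (i * (order G - 1))"
          using h g x by (intro inv_equality) (auto simp: m_comm H.mem_carrier)
        then show ?thesis
          unfolding H'_def using h by blast
      qed
    qed
    moreover have "character_on G H' \<chi>'"
      unfolding character_on_def
    proof (intro conjI ballI)
      show "\<chi>' \<one> = 1"
        using \<chi>'_H \<chi> by (simp add: character_on_def)
      fix x y assume "x \<in> H'" "y \<in> H'"
      then obtain h h' and i j :: nat where "x = h \<otimes> g [^] i" "y = h' \<otimes> g [^] j" "h \<in> H" "h' \<in> H"
        unfolding H'_def by auto
      then show "\<chi>' (x \<otimes> y) = \<chi>' x * \<chi>' y"
        using \<chi> by (simp add: mult \<chi>' power_add character_on_def)
    qed
    ultimately show ?thesis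
      using HH' gH' g(2) \<chi>'_H \<chi>'_g by (intro exI[of _ H'] exI[of _ \<chi>']) auto
  qed
  with k2 k(2) show thesis
    by (rule that)
qed

text \<open>Adjoin elements one at a time, by induction on the number of elements still outside the
  subgroup. Each step succeeds because every complex number has a \<open>k\<close>-th root.\<close>

lemma extend_character:
  assumes fin: "finite (carrier G)" and "subgroup H G" and "character_on G H \<chi>"
  shows "\<exists>\<psi>. character_on G (carrier G) \<psi> \<and> (\<forall>h\<in>H. \<psi> h = \<chi> h)"
  using assms(2,3)
proof (induction "card (carrier G) - card H" arbitrary: H \<chi> rule: less_induct)
  case less
  show ?case
  proof (cases "H = carrier G")
    case False
    have sub: "H \<subseteq> carrier G"
      using less.prems subgroup.subset by blast
    with False obtain g where g: "g \<in> carrier G" "g \<notin> H"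
      by blast
    obtain k where k: "k \<ge> 2"
      and ext: "\<And>w. w ^ k = \<chi> (g [^] k) \<Longrightarrow> \<exists>H' \<chi>'. subgroup H' G \<and> H \<subset> H' \<and> g \<in> H' \<and>
      character_on G H' \<chi>' \<and> (\<forall>h\<in>H. \<chi>' h = \<chi> h) \<and> \<chi>' g = w"
      using extend_character_by_one[OF fin less.prems g] by metis
    obtain w where "w ^ k = \<chi> (g [^] k)"
      using complex_root_exists[of k] k by auto
    then obtain H' \<chi>' where H': "subgroup H' G" "H \<subset> H'" "character_on G H' \<chi>'"
      "\<forall>h\<in>H. \<chi>' h = \<chi> h"
      using ext by blast
    have sub': "H' \<subseteq> carrier G"
      using H' subgroup.subset by blast
    have "card H < card H'" "card H' \<le> card (carrier G)"
      using H' sub' fin by (auto intro!: psubset_card_mono card_mono intro: finite_subset)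
    then have "card (carrier G) - card H' < card (carrier G) - card H"
      by linarith
    from less.hyps[OF this H'(1,3)] show ?thesis
      using H'(2,4) by (metis psubsetD)
  qed (use less in auto)
qed

text \<open>Start from the trivial subgroup, adjoin \<open>x\<close> with a nontrivial root of unity
  as its value, then extend to the whole group.\<close>

lemma separating_character:
  assumes fin: "finite (carrier G)" and x: "x \<in> carrier G" "x \<noteq> \<one>"
  obtains \<chi> where "\<chi> \<in> characters G" "\<chi> x \<noteq> 1"
proof -
  have triv: "subgroup {\<one>} G" "character_on G {\<one>} (\<lambda>_. 1)"
    by (simp_all add: triv_subgroup character_on_def)
  obtain k where k: "k \<ge> 2"
    and ext: "\<And>w. w ^ k = 1 \<Longrightarrow> \<exists>H' \<chi>'. subgroup H' G \<and> {\<one>} \<subset> H' \<and> x \<in> H' \<and>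
      character_on G H' \<chi>' \<and> (\<forall>h\<in>{\<one>}. \<chi>' h = 1) \<and> \<chi>' x = w"
    using extend_character_by_one[OF fin triv, of x] x by (metis singletonD)
  obtain w :: complex where "w ^ k = 1" "w \<noteq> 1"
    using nontrivial_root_of_unity_exists[OF k] .
  then obtain H' \<chi>' where H': "subgroup H' G" "x \<in> H'" "character_on G H' \<chi>'" "\<chi>' x \<noteq> 1"
    using ext by blast
  obtain \<psi> where \<psi>: "character_on G (carrier G) \<psi>" "\<psi> x = \<chi>' x"
    using extend_character[OF fin H'(1,3)] H'(2) by auto
  have "restrict \<psi> (carrier G) \<in> characters G"
    using \<psi> by (simp add: characters_def character_on_def)
  then show thesis
    using that[of "restrict \<psi> (carrier G)"] x \<psi> H'(4) by simp
qed

section \<open>Values, orthogonality and number of the characters\<close>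

lemma character_mult:
  "\<chi> \<in> characters G \<Longrightarrow> x \<in> carrier G \<Longrightarrow> y \<in> carrier G \<Longrightarrow> \<chi> (x \<otimes> y) = \<chi> x * \<chi> y"
  by (simp add: characters_def character_on_def)

lemma character_one: "\<chi> \<in> characters G \<Longrightarrow> \<chi> \<one> = 1"
  by (simp add: characters_def character_on_def)

lemma character_pow_order:
  assumes "\<chi> \<in> characters G" "x \<in> carrier G"
  shows "\<chi> x ^ order G = 1"
  using character_on_pow[of "carrier G" \<chi> x "order G"] assms
  by (simp add: characters_def character_on_def subgroup_self pow_order_eq_1)

lemma norm_character:
  assumes fin: "finite (carrier G)" and "\<chi> \<in> characters G" "x \<in> carrier G"
  shows "cmod (\<chi> x) = 1"
proof -
  have "cmod (\<chi> x) ^ order G = 1"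
    using character_pow_order[OF assms(2,3)] by (metis norm_one norm_power)
  moreover have "order G > 0"
    using fin by (simp add: order_gt_0_iff_finite)
  ultimately show ?thesis
    using power_eq_imp_eq_base[of "cmod (\<chi> x)" "order G" 1] by simp
qed

lemma character_inv:
  assumes fin: "finite (carrier G)" and "\<chi> \<in> characters G" "x \<in> carrier G"
  shows "\<chi> (inv x) = cnj (\<chi> x)"
proof -
  have 1: "\<chi> x * cnj (\<chi> x) = 1"
    using norm_character[OF assms] by (simp flip: complex_norm_square)
  have 2: "\<chi> x * \<chi> (inv x) = 1"
    using assms by (simp flip: character_mult add: character_one)
  from 1 2 show ?thesis
    by (metis mult.commute mult.left_commute mult.right_neutral)
qed

lemma finite_characters:
  assumes fin: "finite (carrier G)"
  shows "finite (characters G)"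
proof (rule finite_subset)
  show "characters G \<subseteq> carrier G \<rightarrow>\<^sub>E {z. z ^ order G = 1}"
    using character_pow_order by (auto simp: PiE_def characters_def)
  have "order G > 0"
    using fin by (simp add: order_gt_0_iff_finite)
  then show "finite (carrier G \<rightarrow>\<^sub>E {z :: complex. z ^ order G = 1})"
    using fin by (intro finite_PiE finite_roots_unity) auto
qed

text \<open>Multiplication by a character \<open>\<psi>\<close> with \<psi>(x) \<noteq> 1 permutes
  the characters, so the sum equals \<psi>(x) times itself.\<close>

lemma sum_characters_eq_0:
  assumes fin: "finite (carrier G)" and x: "x \<in> carrier G" "x \<noteq> \<one>"
  shows "(\<Sum>\<chi>\<in>characters G. \<chi> x) = 0"
proof -
  obtain \<psi> where \<psi>: "\<psi> \<in> characters G" "\<psi> x \<noteq> 1"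
    using separating_character[OF fin x] .
  define T where "T \<chi> = restrict (\<lambda>y. \<psi> y * \<chi> y) (carrier G)" for \<chi>
  have "T ` characters G \<subseteq> characters G"
    using \<psi>(1) by (auto simp: T_def characters_def character_on_def)
  \<comment> \<open>Values of \<open>\<psi>\<close> have modulus 1, so they can be cancelled; an
    injective self-map of a finite set is onto.\<close>
  moreover have inj: "inj_on T (characters G)"
  proof (rule inj_onI)
    fix \<chi> \<chi>' assume *: "\<chi> \<in> characters G" "\<chi>' \<in> characters G" "T \<chi> = T \<chi>'"
    have "\<chi> y = \<chi>' y" if y: "y \<in> carrier G" for y
      using fun_cong[OF *(3), of y] norm_character[OF fin \<psi>(1) y] y by (auto simp: T_def)
    with * show "\<chi> = \<chi>'"
      by (auto simp: characters_def intro: extensionalityI)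
  qed
  ultimately have "T ` characters G = characters G"
    using finite_characters[OF fin] by (intro endo_inj_surj)
  then have "(\<Sum>\<chi>\<in>characters G. \<chi> x) = (\<Sum>\<chi>\<in>characters G. T \<chi> x)"
    using sum.reindex[OF inj, of "\<lambda>\<chi>. \<chi> x"] by simp
  also have "\<dots> = \<psi> x * (\<Sum>\<chi>\<in>characters G. \<chi> x)"
    using x by (simp add: T_def sum_distrib_left)
  finally show ?thesis
    using \<psi>(2) by simp
qed

text \<open>The dual argument: translating the group by \<open>y\<close> multiplies the sum by
  \<chi>(y).\<close>

lemma sum_nontrivial_character_eq_0:
  assumes fin: "finite (carrier G)" and \<chi>: "\<chi> \<in> characters G" and y: "y \<in> carrier G" "\<chi> y \<noteq> 1"
  shows "(\<Sum>x\<in>carrier G. \<chi> x) = 0"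
proof -
  have "bij_betw (\<lambda>x. y \<otimes> x) (carrier G) (carrier G)"
    using y by (intro bij_betwI[where g = "\<lambda>x. inv y \<otimes> x"]) (auto simp flip: m_assoc)
  then have "(\<Sum>x\<in>carrier G. \<chi> x) = (\<Sum>x\<in>carrier G. \<chi> (y \<otimes> x))"
    by (rule sum.reindex_bij_betw[symmetric])
  also have "\<dots> = \<chi> y * (\<Sum>x\<in>carrier G. \<chi> x)"
    using \<chi> y by (simp add: character_mult sum_distrib_left)
  finally show ?thesis
    using y by simp
qed

text \<open>Double counting of \<chi>(x) over all pairs: by the two orthogonality relations, only
  the identity contributes in one order of summation and only the trivial character in the
  other.\<close>

lemma card_characters:
  assumes fin: "finite (carrier G)"
  shows "card (characters G) = order G"
proof -
  define \<chi>0 :: "'a \<Rightarrow> complex" where "\<chi>0 = restrict (\<lambda>_. 1) (carrier G)"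
  have \<chi>0: "\<chi>0 \<in> characters G"
    by (simp add: \<chi>0_def characters_def character_on_def)
  have "of_nat (card (characters G)) = (\<Sum>x\<in>carrier G. \<Sum>\<chi>\<in>characters G. \<chi> x)"
    using fin by (subst sum.remove[of _ \<one>])
      (auto simp: character_one sum_characters_eq_0 intro!: sum.neutral)
  also have "\<dots> = (\<Sum>\<chi>\<in>characters G. \<Sum>x\<in>carrier G. \<chi> x)"
    by (rule sum.swap)
  also have "\<dots> = (\<Sum>x\<in>carrier G. \<chi>0 x) + (\<Sum>\<chi>\<in>characters G - {\<chi>0}. \<Sum>x\<in>carrier G. \<chi> x)"
    using \<chi>0 by (intro sum.remove finite_characters fin)
  also have "(\<Sum>x\<in>carrier G. \<chi>0 x) = of_nat (order G)"
    by (simp add: \<chi>0_def order_def)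
  also have "(\<Sum>\<chi>\<in>characters G - {\<chi>0}. \<Sum>x\<in>carrier G. \<chi> x) = 0"
  proof (rule sum.neutral, rule ballI)
    fix \<chi> assume \<chi>: "\<chi> \<in> characters G - {\<chi>0}"
    then obtain y where "y \<in> carrier G" "\<chi> y \<noteq> \<chi>0 y"
      using \<chi>0 by (metis (no_types, lifting) DiffE characters_def extensionalityI mem_Collect_eq
          singletonI)
    then have y: "y \<in> carrier G" "\<chi> y \<noteq> 1"
      by (auto simp: \<chi>0_def)
    show "(\<Sum>x\<in>carrier G. \<chi> x) = 0"
      using \<chi> by (intro sum_nontrivial_character_eq_0[where y = y] fin y) auto
  qed
  finally have "of_nat (card (characters G)) = (of_nat (order G) :: complex)"
    by simp
  then show ?thesis
    by (simp only: of_nat_eq_iff)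
qed

lemma sum_characters:
  assumes "finite (carrier G)" "x \<in> carrier G"
  shows "(\<Sum>\<chi>\<in>characters G. \<chi> x) = (if x = \<one> then of_nat (order G) else 0)"
  using assms by (simp add: sum_characters_eq_0 character_one card_characters)

end

section \<open>The autocorrelation of a set\<close>

text \<open>For A inside an abelian group and x in the group this is |A \<inter> (A + x)|, the
  number of representations of x as a difference of two elements of A.\<close>

definition translate_overlap :: "('a, 'b) monoid_scheme \<Rightarrow> 'a set \<Rightarrow> 'a \<Rightarrow> nat"
  where "translate_overlap G A x = card {y \<in> A. y \<otimes>\<^bsub>G\<^esub> inv\<^bsub>G\<^esub> x \<in> A}"

context comm_group
begin

text \<open>The factor at x - y is nonzero exactly when y - x lies in A.\<close>

lemma convolution_eq_translate_overlap:
  assumes fin: "finite (carrier G)" and A: "A \<subseteq> carrier G" and x: "x \<in> carrier G"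
  shows "convolution G (indicator A) (indicator (set_inv A)) x
    = real (translate_overlap G A x) / real (order G)"
proof -
  have iff: "x \<otimes> inv y \<in> set_inv A \<longleftrightarrow> y \<otimes> inv x \<in> A" if y: "y \<in> carrier G" for y
  proof -
    have inv: "inv (y \<otimes> inv x) = x \<otimes> inv y" "inv (x \<otimes> inv y) = y \<otimes> inv x"
      using x y by (simp_all add: inv_mult m_comm)
    show ?thesis
    proof
      assume "x \<otimes> inv y \<in> set_inv A"
      then obtain a where "a \<in> A" "x \<otimes> inv y = inv a"
        by (auto simp: SET_INV_def)
      then show "y \<otimes> inv x \<in> A"
        using inv A by (metis inv_inv subsetD)
    next
      assume "y \<otimes> inv x \<in> A"
      then show "x \<otimes> inv y \<in> set_inv A"
        unfolding SET_INV_def using inv by force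
    qed
  qed
  have "(\<Sum>y\<in>carrier G. indicator A y * indicator (set_inv A) (x \<otimes> inv y))
      = (\<Sum>y\<in>carrier G. indicator {y \<in> A. y \<otimes> inv x \<in> A} y :: real)"
    by (intro sum.cong) (auto simp: indicator_def iff)
  also have "\<dots> = real (card (carrier G \<inter> {y \<in> A. y \<otimes> inv x \<in> A}))"
    using fin by (simp add: indicator_def sum.If_cases Int_def)
  also have "carrier G \<inter> {y \<in> A. y \<otimes> inv x \<in> A} = {y \<in> A. y \<otimes> inv x \<in> A}"
    using A by auto
  finally show ?thesis
    by (simp add: convolution_def translate_overlap_def)
qed

lemma translate_overlap_le:
  "finite A \<Longrightarrow> translate_overlap G A x \<le> card A"
  unfolding translate_overlap_def by (rule card_mono) auto

lemma translate_overlap_eq_0: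
  assumes A: "A \<subseteq> carrier G" and x: "x \<in> carrier G" "x \<notin> diff_set G A"
  shows "translate_overlap G A x = 0"
proof -
  have "\<not> (y \<in> A \<and> y \<otimes> inv x \<in> A)" for y
  proof
    assume y: "y \<in> A \<and> y \<otimes> inv x \<in> A"
    then have "y \<in> carrier G"
      using A by auto
    then have "x = y \<otimes> inv (y \<otimes> inv x)"
      using x by (simp add: inv_mult flip: m_assoc)
    then show False
      using x(2) y unfolding diff_set_def set_mult_def SET_INV_def by blast
  qed
  then have "{y \<in> A. y \<otimes> inv x \<in> A} = {}"
    by auto
  then show ?thesis
    unfolding translate_overlap_def by (simp only: card.empty)
qed

lemma diff_set_subset_carrier: "A \<subseteq> carrier G \<Longrightarrow> diff_set G A \<subseteq> carrier G"
  by (auto simp: diff_set_def set_mult_def SET_INV_def)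

text \<open>Each ordered pair of elements of A is counted once, at its difference.\<close>

lemma sum_translate_overlap:
  assumes fin: "finite (carrier G)" and A: "A \<subseteq> carrier G"
  shows "(\<Sum>x\<in>carrier G. translate_overlap G A x) = (card A)\<^sup>2"
proof -
  have finA: "finite A"
    using fin A finite_subset by blast
  have "(\<Sum>x\<in>carrier G. translate_overlap G A x)
      = (\<Sum>x\<in>carrier G. \<Sum>y\<in>A. if y \<otimes> inv x \<in> A then 1 else 0)"
    unfolding translate_overlap_def card_eq_sum
    by (rule sum.cong[OF refl], rule sum.inter_filter[OF finA])
  also have "\<dots> = (\<Sum>y\<in>A. \<Sum>x\<in>carrier G. if y \<otimes> inv x \<in> A then 1 else 0)"
    by (rule sum.swap)
  also have "\<dots> = (\<Sum>y\<in>A. card A)"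
  proof (intro sum.cong refl)
    fix y assume "y \<in> A"
    then have y: "y \<in> carrier G"
      using A by auto
    have inv: "y \<otimes> inv (y \<otimes> inv x) = x" if "x \<in> carrier G" for x
      using that y by (simp add: inv_mult flip: m_assoc)
    have "bij_betw (\<lambda>x. y \<otimes> inv x) (carrier G) (carrier G)"
      using y inv by (intro bij_betwI[where g = "\<lambda>x. y \<otimes> inv x"]) auto
    then have "(\<Sum>x\<in>carrier G. if y \<otimes> inv x \<in> A then 1 else 0)
        = (\<Sum>x\<in>carrier G. if x \<in> A then 1 else 0 :: nat)"
      by (rule sum.reindex_bij_betw)
    also have "\<dots> = card (carrier G \<inter> A)"
      using fin by (simp add: sum.If_cases)
    also have "carrier G \<inter> A = A"
      using A by auto
    finally show "(\<Sum>x\<in>carrier G. if y \<otimes> inv x \<in> A then 1 else 0) = card A" .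
  qed
  also have "\<dots> = (card A)\<^sup>2"
    by (simp add: power2_eq_square)
  finally show ?thesis .
qed

text \<open>Fourier inversion for the autocorrelation. Expanding the square gives a sum of \<chi>(a
  - b + x) over pairs; orthogonality keeps only a = b - x, and such pairs are counted by the
  overlap.\<close>

lemma sum_spectrum_characters:
  assumes fin: "finite (carrier G)" and A: "A \<subseteq> carrier G" and x: "x \<in> carrier G"
  shows "(\<Sum>\<chi>\<in>characters G. of_real ((cmod (\<Sum>a\<in>A. \<chi> a))\<^sup>2) * \<chi> x)
    = of_nat (order G * translate_overlap G A x)"
proof -
  have finA: "finite A"
    using fin A finite_subset by blast
  have char: "\<chi> (a \<otimes> inv b \<otimes> x) = \<chi> a * cnj (\<chi> b) * \<chi> x"
    if "\<chi> \<in> characters G" "a \<in> A" "b \<in> A" for \<chi> a b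
    using that A x by (auto simp: character_mult character_inv[OF fin] subset_iff)
  have one_iff: "a \<otimes> inv b \<otimes> x = \<one> \<longleftrightarrow> a = b \<otimes> inv x" if "a \<in> A" "b \<in> A" for a b
  proof -
    have c: "a \<in> carrier G" "b \<in> carrier G"
      using that A by auto
    then have "a \<otimes> inv b \<otimes> x = a \<otimes> inv (b \<otimes> inv x)"
      using x by (simp add: inv_mult m_assoc)
    then show ?thesis
      using c x by (simp add: inv_solve_right')
  qed
  have "(\<Sum>\<chi>\<in>characters G. of_real ((cmod (\<Sum>a\<in>A. \<chi> a))\<^sup>2) * \<chi> x)
      = (\<Sum>\<chi>\<in>characters G. \<Sum>b\<in>A. \<Sum>a\<in>A. \<chi> (a \<otimes> inv b \<otimes> x))"
  proof (intro sum.cong refl)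
    fix \<chi> assume \<chi>: "\<chi> \<in> characters G"
    have "of_real ((cmod (\<Sum>a\<in>A. \<chi> a))\<^sup>2) * \<chi> x = (\<Sum>b\<in>A. \<Sum>a\<in>A. \<chi> a * cnj (\<chi> b) * \<chi> x)"
      by (simp only: complex_norm_square cnj_sum sum_distrib_left sum_distrib_right)
    then show "of_real ((cmod (\<Sum>a\<in>A. \<chi> a))\<^sup>2) * \<chi> x = (\<Sum>b\<in>A. \<Sum>a\<in>A. \<chi> (a \<otimes> inv b \<otimes> x))"
      using \<chi> by (simp add: char)
  qed
  also have "\<dots> = (\<Sum>b\<in>A. \<Sum>a\<in>A. \<Sum>\<chi>\<in>characters G. \<chi> (a \<otimes> inv b \<otimes> x))"
    by (subst sum.swap, intro sum.cong refl, rule sum.swap)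
  also have "\<dots> = (\<Sum>b\<in>A. \<Sum>a\<in>A. if a = b \<otimes> inv x then of_nat (order G) else 0)"
    using A x by (intro sum.cong refl) (auto simp: sum_characters[OF fin] one_iff subset_iff)
  also have "\<dots> = (\<Sum>b\<in>A. if b \<otimes> inv x \<in> A then of_nat (order G) else 0)"
    using finA by simp
  also have "\<dots> = of_nat (order G * translate_overlap G A x)"
    using finA by (simp add: translate_overlap_def flip: sum.inter_filter)
  finally show ?thesis .
qed

text \<open>Dividing the squared Fourier coefficients by n |A| turns them into a probability
  distribution on characters. Real parts are harmless since the average is real.\<close>

lemma translate_overlap_spectral_average:
  assumes fin: "finite (carrier G)" and A: "A \<subseteq> carrier G" "A \<noteq> {}"
  obtains p :: "('a \<Rightarrow> complex) \<Rightarrow> real"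
  where "\<And>\<chi>. 0 \<le> p \<chi>" "sum p (characters G) = 1"
    and "\<And>x. x \<in> carrier G \<Longrightarrow>
      (\<Sum>\<chi>\<in>characters G. p \<chi> * Re (\<chi> x)) = real (translate_overlap G A x) / real (card A)"
proof -
  define M where "M = real (order G) * real (card A)"
  have cardA: "card A > 0"
    using A finite_subset[OF A(1) fin] by (simp add: card_gt_0_iff)
  then have "M > 0"
    using fin cardA by (simp add: M_def order_gt_0_iff_finite)
  define p where "p \<chi> = (cmod (\<Sum>a\<in>A. \<chi> a))\<^sup>2 / M" for \<chi> :: "'a \<Rightarrow> complex"
  have avg: "(\<Sum>\<chi>\<in>characters G. p \<chi> * Re (\<chi> x)) = real (translate_overlap G A x) / real (card A)"
    if x: "x \<in> carrier G" for x
  proof -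
    have "(\<Sum>\<chi>\<in>characters G. p \<chi> * Re (\<chi> x))
        = Re (\<Sum>\<chi>\<in>characters G. of_real ((cmod (\<Sum>a\<in>A. \<chi> a))\<^sup>2) * \<chi> x) / M"
      by (simp add: p_def sum_divide_distrib)
    also have "\<dots> = real (order G * translate_overlap G A x) / M"
      unfolding sum_spectrum_characters[OF fin A(1) x] by simp
    also have "\<dots> = real (translate_overlap G A x) / real (card A)"
      using \<open>M > 0\<close> by (cases "order G = 0") (simp_all add: M_def field_simps)
    finally show ?thesis .
  qed
  \<comment> \<open>Evaluation at the identity is Parseval's identity and yields total weight
    1.\<close>
  have "translate_overlap G A \<one> = card A"
  proof -
    have "{y \<in> A. y \<otimes> inv \<one> \<in> A} = A"
      using A by auto
    then show ?thesis
      by (simp add: translate_overlap_def)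
  qed
  then have "sum p (characters G) = 1"
    using avg[of \<one>] cardA by (simp add: character_one)
  moreover have "0 \<le> p \<chi>" for \<chi>
    using \<open>M > 0\<close> by (simp add: p_def)
  ultimately show thesis
    using avg by (intro that)
qed

end

section \<open>A popular dyadic level\<close>

text \<open>Telescoping with 1/(L+1)^2 \<le> 1/L - 1/(L+1). The subtracted term carries the
  induction, and the constant is 3 because levels 0 and 1 both contribute 1.\<close>

lemma sum_inverse_squares_le:
  "(\<Sum>l\<le>L. 1 / (real (max 1 l))\<^sup>2) \<le> 3 - 1 / real (max 1 L)"
proof (induction L)
  case (Suc L)
  show ?case
  proof (cases "L = 0")
    case False
    have "1 / (real (Suc L))\<^sup>2 \<le> 1 / (real L * real (Suc L))"
      using False by (intro divide_left_mono) (auto simp: power2_eq_square)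
    also have "\<dots> = 1 / real L - 1 / real (Suc L)"
      using False by (simp add: field_simps)
    finally show ?thesis
      using Suc False by (simp add: max_def)
  qed simp
qed simp

text \<open>Take the least exponent satisfying the lower bound; minimality gives the upper
  bound.\<close>

lemma dyadic_level_exists:
  fixes r N :: real
  assumes "r \<le> N" and "N / 2 ^ (L + 1) < r"
  obtains l where "l \<le> L" "N / 2 ^ (l + 1) < r" "r \<le> N / 2 ^ l"
proof -
  define l where "l = (LEAST l. N / 2 ^ (l + 1) < r)"
  have "N / 2 ^ (l + 1) < r" "l \<le> L"
    unfolding l_def using assms(2) by (rule LeastI, rule Least_le)
  moreover have "r \<le> N / 2 ^ l"
  proof (cases l)
    case 0
    then show ?thesis using assms(1) by simp
  next
    case (Suc l')
    then have "\<not> N / 2 ^ (l' + 1) < r"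
      using not_less_Least[of l' "\<lambda>l. N / 2 ^ (l + 1) < r"] by (simp add: l_def)
    then show ?thesis using Suc by simp
  qed
  ultimately show thesis
    by (intro that)
qed

text \<open>Pigeonhole on the mass N^2. Values at most N/2^(L+1) carry at most half of it. If no
  level were popular, level l would carry less than N^2/(6 max(1,l)^2), and all levels together less
  than the other half, as the inverse squares sum to at most 3.\<close>

lemma popular_dyadic_level:
  fixes r :: "'x \<Rightarrow> real" and N K :: real
  assumes D: "finite D" "real (card D) \<le> K * N" and N: "N > 0"
    and r: "\<And>x. x \<in> D \<Longrightarrow> r x \<le> N" "(\<Sum>x\<in>D. r x) = N\<^sup>2" and K: "K \<le> 2 ^ L"
  shows "\<exists>l\<le>L. 1 / 6 * 2 ^ l * N / (real (max 1 l))\<^sup>2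
    \<le> real (card {x \<in> D. r x \<in> {N / 2 ^ (l + 1) <.. N / 2 ^ l}})"
proof (rule ccontr)
  assume none: "\<not> ?thesis"
  define S where "S l = {x \<in> D. r x \<in> {N / 2 ^ (l + 1) <.. N / 2 ^ l}}" for l :: nat
  have small: "real (card (S l)) < 1 / 6 * 2 ^ l * N / (real (max 1 l))\<^sup>2" if "l \<le> L" for l
    using none that unfolding S_def by (meson not_le)
  \<comment> \<open>Each value is majorised by the cut-off or by the upper end of its level.\<close>
  have pointwise: "r x \<le> N / 2 ^ (L + 1) + (\<Sum>l\<le>L. if x \<in> S l then N / 2 ^ l else 0)"
    if x: "x \<in> D" for x
  proof (cases "r x \<le> N / 2 ^ (L + 1)")
    case True
    have "0 \<le> (\<Sum>l\<le>L. if x \<in> S l then N / 2 ^ l else 0)"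
      using N by (intro sum_nonneg) auto
    with True show ?thesis by linarith
  next
    case False
    then obtain l where l: "l \<le> L" "N / 2 ^ (l + 1) < r x" "r x \<le> N / 2 ^ l"
      using dyadic_level_exists[OF r(1)[OF x], of L] by auto
    then have "r x \<le> (if x \<in> S l then N / 2 ^ l else 0)"
      using x by (simp add: S_def)
    also have "\<dots> \<le> (\<Sum>l\<le>L. if x \<in> S l then N / 2 ^ l else 0)"
      using N l by (intro member_le_sum) auto
    finally show ?thesis
      using N by (smt (verit) zero_less_divide_iff zero_less_power)
  qed
  have "N\<^sup>2 \<le> (\<Sum>x\<in>D. N / 2 ^ (L + 1) + (\<Sum>l\<le>L. if x \<in> S l then N / 2 ^ l else 0))"
    unfolding r(2)[symmetric] by (intro sum_mono pointwise)
  also have "\<dots> = real (card D) * (N / 2 ^ (L + 1))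
      + (\<Sum>l\<le>L. \<Sum>x\<in>D. if x \<in> S l then N / 2 ^ l else 0)"
    by (simp add: sum.distrib) (rule sum.swap)
  also have "(\<Sum>l\<le>L. \<Sum>x\<in>D. if x \<in> S l then N / 2 ^ l else 0)
      = (\<Sum>l\<le>L. real (card (S l)) * (N / 2 ^ l))"
  proof (intro sum.cong refl)
    fix l
    have "D \<inter> S l = S l"
      by (auto simp: S_def)
    then show "(\<Sum>x\<in>D. if x \<in> S l then N / 2 ^ l else 0) = real (card (S l)) * (N / 2 ^ l)"
      using D by (simp flip: sum.inter_restrict)
  qed
  also have "\<dots> < (\<Sum>l\<le>L. 1 / 6 * 2 ^ l * N / (real (max 1 l))\<^sup>2 * (N / 2 ^ l))"
    using N small by (intro sum_strict_mono mult_strict_right_mono) auto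
  also have "\<dots> = (\<Sum>l\<le>L. N\<^sup>2 / 6 * (1 / (real (max 1 l))\<^sup>2))"
    by (intro sum.cong refl) (simp add: field_simps power2_eq_square)
  also have "\<dots> = N\<^sup>2 / 6 * (\<Sum>l\<le>L. 1 / (real (max 1 l))\<^sup>2)"
    by (simp only: sum_distrib_left)
  also have "\<dots> \<le> N\<^sup>2 / 6 * 3"
    using sum_inverse_squares_le[of L]
    by (intro mult_left_mono) (auto intro: order_trans)
  \<comment> \<open>The cut-off is charged to all of \<open>D\<close>, which has at most K N \<le>
    2^L N points.\<close>
  also have "real (card D) * (N / 2 ^ (L + 1)) \<le> 2 ^ L * N * (N / 2 ^ (L + 1))"
    using D(2) K N by (intro mult_right_mono) (auto intro: order_trans)
  also have "\<dots> = N\<^sup>2 / 2"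
    by (simp add: field_simps power2_eq_square)
  finally show False by simp
qed

section \<open>Covering level sets by few sets\<close>

text \<open>The sample mean is thresholded at \<open>e\<close>, with the division cleared. No set A
  enters, so counting lists of characters bounds the number of such sets.\<close>

definition spectral_set :: "('a, 'b) monoid_scheme \<Rightarrow> real \<Rightarrow> ('a \<Rightarrow> complex) list \<Rightarrow> 'a set"
  where "spectral_set G e cs = {x \<in> carrier G. e * real (length cs) < (\<Sum>\<chi>\<leftarrow>cs. Re (\<chi> x))}"

context comm_group
begin

lemma level_set_eq:
  assumes fin: "finite (carrier G)" and A: "A \<subseteq> carrier G"
    and \<alpha>: "real (card A) = \<alpha> * real (order G)"
  shows "level_set G \<alpha> A l = {x \<in> carrier G. real (translate_overlap G A x)
    \<in> {real (card A) / 2 ^ (l + 1) <.. real (card A) / 2 ^ l}}"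
proof -
  have "order G > 0"
    using fin by (simp add: order_gt_0_iff_finite)
  then show ?thesis
    unfolding level_set_def \<alpha>
    by (intro Collect_cong conj_cong refl)
      (simp add: convolution_eq_translate_overlap[OF fin A] field_simps)
qed

text \<open>With e = 2^(-l-2), the correlation exceeds 2 e on the level set and vanishes off A - A.
  A sample mean that errs by less than \<open>e\<close> therefore separates the two regions at
  threshold \<open>e\<close>.\<close>

lemma level_set_covered:
  assumes fin: "finite (carrier G)" and A: "A \<subseteq> carrier G" "A \<noteq> {}"
    and \<alpha>: "real (card A) = \<alpha> * real (order G)"
    and m: "256 * 2 ^ (2 * l) * ln (real (order G)) < real m"
  obtains cs where "set cs \<subseteq> characters G" "length cs = m"
    and "level_set G \<alpha> A l \<subseteq> spectral_set G (1 / 2 ^ (l + 2)) cs"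
    and "spectral_set G (1 / 2 ^ (l + 2)) cs \<subseteq> diff_set G A"
proof -
  define e :: real where "e = 1 / 2 ^ (l + 2)"
  define \<phi> where "\<phi> x = real (translate_overlap G A x) / real (card A)" for x
  \<comment> \<open>Only a lower bound on the level set and an upper bound off \<open>A - A\<close> are needed, so one sign
    per point suffices.\<close>
  define s :: "'a \<Rightarrow> real" where "s x = (if x \<in> level_set G \<alpha> A l then 1 else - 1)" for x
  have finA: "finite A"
    using fin A finite_subset by blast
  have cardA: "card A > 0"
    using A finA by (simp add: card_gt_0_iff)
  obtain p :: "('a \<Rightarrow> complex) \<Rightarrow> real" where p: "\<And>\<chi>. 0 \<le> p \<chi>" "sum p (characters G) = 1"
    and avg: "\<And>x. x \<in> carrier G \<Longrightarrow> (\<Sum>\<chi>\<in>characters G. p \<chi> * Re (\<chi> x)) = \<phi> x"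
    using translate_overlap_spectral_average[OF fin A] unfolding \<phi>_def by blast
  have bound: "\<bar>s x * (\<phi> x - Re (\<chi> x))\<bar> \<le> 2" if "x \<in> carrier G" "\<chi> \<in> characters G" for x \<chi>
  proof -
    have "\<bar>Re (\<chi> x)\<bar> \<le> 1"
      using abs_Re_le_cmod[of "\<chi> x"] norm_character[OF fin that(2,1)] by simp
    moreover have "0 \<le> \<phi> x" "\<phi> x \<le> 1"
      using translate_overlap_le[OF finA, of x] cardA by (simp_all add: \<phi>_def)
    ultimately show ?thesis
      by (auto simp: s_def)
  qed
  have mean: "(\<Sum>\<chi>\<in>characters G. p \<chi> * (s x * (\<phi> x - Re (\<chi> x)))) = 0" if "x \<in> carrier G" for x
  proof -
    have "(\<Sum>\<chi>\<in>characters G. p \<chi> * (s x * (\<phi> x - Re (\<chi> x))))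
        = s x * (sum p (characters G) * \<phi> x - (\<Sum>\<chi>\<in>characters G. p \<chi> * Re (\<chi> x)))"
      by (simp add: sum_distrib_left sum_distrib_right algebra_simps sum_subtractf)
    then show ?thesis
      using p avg that by simp
  qed
  have e: "0 < e" "e \<le> 4"
    using power_increasing[of 0 "l + 2" "2 :: real"] by (simp_all add: e_def divide_le_eq)
  \<comment> \<open>Hence 16/e^2 = 256 * 4^l, the factor in the hypothesis on
    \<open>m\<close>.\<close>
  have "e\<^sup>2 = 1 / (16 * 2 ^ (2 * l))"
    by (simp add: e_def power_divide power_add power_mult_distrib mult.commute[of 2] power_mult)
  then have m': "16 * ln (real (card (carrier G))) < e\<^sup>2 * real m"
    using m by (simp only:) (simp add: order_def field_simps)
  obtain cs where cs: "set cs \<subseteq> characters G" "length cs = m"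
    and dev: "\<And>x. x \<in> carrier G \<Longrightarrow> (\<Sum>\<chi>\<leftarrow>cs. s x * (\<phi> x - Re (\<chi> x))) < e * real m"
  proof (rule exists_sample_deviation_less[where f = "\<lambda>x \<chi>. s x * (\<phi> x - Re (\<chi> x))"
        and p = p and \<Gamma> = "characters G" and X = "carrier G" and e = e and m = m])
    show "\<bar>s x * (\<phi> x - Re (\<chi> x))\<bar> \<le> 2" if "x \<in> carrier G" "\<chi> \<in> characters G" for x \<chi>
      using that by (rule bound)
    show "(\<Sum>\<chi>\<in>characters G. p \<chi> * (s x * (\<phi> x - Re (\<chi> x)))) = 0" if "x \<in> carrier G" for x
      using that by (rule mean)
  qed (use p fin e m' in blast)+
  have dev': "s x * (real m * \<phi> x - (\<Sum>\<chi>\<leftarrow>cs. Re (\<chi> x))) < e * real m" if "x \<in> carrier G" for x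
    using dev[OF that] cs(2)
    by (simp add: sum_list_const_mult sum_list_subtractf sum_list_triv)
  have "0 \<le> ln (real (order G))"
    using fin order_gt_0_iff_finite by simp
  \<comment> \<open>Positivity preserves the strict inequality 2 e < \<phi>(x) after multiplication
    by \<open>m\<close>.\<close>
  then have "real m > 0"
    using m by (smt (verit) mult_nonneg_nonneg zero_le_power)
  have "level_set G \<alpha> A l \<subseteq> spectral_set G e cs"
  proof
    fix x assume x: "x \<in> level_set G \<alpha> A l"
    then have xG: "x \<in> carrier G"
      by (simp add: level_set_def)
    have "real (card A) / 2 ^ (l + 1) < real (translate_overlap G A x)"
      using x by (simp add: level_set_eq[OF fin A(1) \<alpha>])
    then have "2 * e < \<phi> x"
      using cardA by (simp add: \<phi>_def e_def field_simps)
    then have "real m * (2 * e) < real m * \<phi> x"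
      using \<open>real m > 0\<close> by simp
    \<comment> \<open>Here the sign is 1: the sample sum exceeds m \<phi>(x) - e m > e m.\<close>
    then show "x \<in> spectral_set G e cs"
      using dev'[OF xG] x xG cs(2) by (simp add: spectral_set_def s_def algebra_simps)
  qed
  moreover have "spectral_set G e cs \<subseteq> diff_set G A"
  proof
    fix x assume x: "x \<in> spectral_set G e cs"
    then have xG: "x \<in> carrier G"
      by (simp add: spectral_set_def)
    show "x \<in> diff_set G A"
    proof (rule ccontr)
      assume "x \<notin> diff_set G A"
      then have 0: "translate_overlap G A x = 0"
        using A xG by (intro translate_overlap_eq_0)
      then have "x \<notin> level_set G \<alpha> A l"
        by (auto simp: level_set_eq[OF fin A(1) \<alpha>] not_less)
      \<comment> \<open>Here the sign is -1 and \<phi>(x) = 0: the sample sum is below e m,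
        contradicting membership.\<close>
      then show False
        using dev'[OF xG] x cs(2) 0 by (simp add: s_def \<phi>_def spectral_set_def)
    qed
  qed
  ultimately show thesis
    using cs that unfolding e_def by blast
qed

text \<open>The pigeonhole principle applied to the overlaps on A - A, which carry the full mass
  |A|^2.\<close>

lemma popular_level_set:
  assumes fin: "finite (carrier G)" and A: "A \<subseteq> carrier G" "A \<noteq> {}"
    and \<alpha>: "real (card A) = \<alpha> * real (order G)"
    and K: "K \<ge> 1" "real (card (diff_set G A)) \<le> K * real (card A)"
  obtains l where "int l \<le> \<lceil>log 2 K\<rceil>"
    and "1 / 6 * 2 ^ l * \<alpha> * real (order G) / (real (max 1 l))\<^sup>2 \<le> real (card (level_set G \<alpha> A l))"
proof -
  \<comment> \<open>Rounding up ensures K \<le> 2^L, as the pigeonhole argument requires.\<close>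
  define L where "L = nat \<lceil>log 2 K\<rceil>"
  define D where "D = diff_set G A"
  have "log 2 K \<ge> 0"
    using K by simp
  then have L: "int L = \<lceil>log 2 K\<rceil>"
    by (simp add: L_def)
  have "K = 2 powr (log 2 K)"
    using K by simp
  also have "\<dots> \<le> 2 powr (real L)"
    using L by (intro powr_mono) linarith+
  finally have KL: "K \<le> 2 ^ L"
    by (simp add: powr_realpow)
  have finA: "finite A"
    using fin A finite_subset by blast
  have N: "real (card A) > 0"
    using A finA by (simp add: card_gt_0_iff)
  have D: "D \<subseteq> carrier G"
    unfolding D_def using A(1) by (rule diff_set_subset_carrier)
  have "(\<Sum>x\<in>D. translate_overlap G A x) = (\<Sum>x\<in>carrier G. translate_overlap G A x)"
    using A fin D unfolding D_def by (intro sum.mono_neutral_left) (auto simp: translate_overlap_eq_0)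
  then have sum: "(\<Sum>x\<in>D. real (translate_overlap G A x)) = (real (card A))\<^sup>2"
    unfolding sum_translate_overlap[OF fin A(1)] by (metis of_nat_power of_nat_sum)
  have le: "real (translate_overlap G A x) \<le> real (card A)" for x
    using translate_overlap_le[OF finA] by simp
  obtain l where l: "l \<le> L" "1 / 6 * 2 ^ l * real (card A) / (real (max 1 l))\<^sup>2
      \<le> real (card {x \<in> D. real (translate_overlap G A x)
          \<in> {real (card A) / 2 ^ (l + 1) <.. real (card A) / 2 ^ l}})"
    using popular_dyadic_level[OF finite_subset[OF D fin] K(2)[folded D_def] N le sum KL] by blast
  have "card {x \<in> D. real (translate_overlap G A x)
          \<in> {real (card A) / 2 ^ (l + 1) <.. real (card A) / 2 ^ l}} \<le> card (level_set G \<alpha> A l)"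
    unfolding level_set_eq[OF fin A(1) \<alpha>] using fin D by (intro card_mono) auto
  then have "1 / 6 * 2 ^ l * (\<alpha> * real (order G)) / (real (max 1 l))\<^sup>2 \<le> real (card (level_set G \<alpha> A l))"
    using l(2) unfolding \<alpha>[symmetric] by linarith
  with l(1) L show thesis
    by (intro that[of l]) (auto simp: mult.assoc)
qed

text \<open>Take the spectral sets of all lists of m(l) characters, at most n^m(l) sets. One family
  serves all A and all densities at once.\<close>

lemma covering_family:
  assumes fin: "finite (carrier G)"
  obtains \<F> :: "nat \<Rightarrow> 'a set set"
  where "\<And>l. \<F> l \<subseteq> Pow (carrier G)"
    and "\<And>l. real (card (\<F> l)) \<le> exp (258 * 2 ^ (2 * l) * (ln (real (order G)))\<^sup>2)"
    and "\<And>\<alpha> A l. A \<subseteq> carrier G \<Longrightarrow> A \<noteq> {} \<Longrightarrow> real (card A) = \<alpha> * real (order G) \<Longrightarrow>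
      \<exists>F\<in>\<F> l. level_set G \<alpha> A l \<subseteq> F \<and> F \<subseteq> diff_set G A"
proof -
  define n where "n = order G"
  have n: "n \<ge> 1"
    using fin order_gt_0_iff_finite by (simp add: n_def Suc_leI)
  \<comment> \<open>The least natural number strictly above the sampling bound.\<close>
  define m where "m l = nat \<lfloor>256 * 2 ^ (2 * l) * ln (real n)\<rfloor> + 1" for l
  have ln_n: "ln (real n) \<ge> 0"
    using n by simp
  have m_gt: "256 * 2 ^ (2 * l) * ln (real n) < real (m l)" for l
    unfolding m_def by linarith
  have m_le: "real (m l) \<le> 256 * 2 ^ (2 * l) * ln (real n) + 1" for l
  proof -
    have "0 \<le> 256 * 2 ^ (2 * l) * ln (real n)"
      using ln_n by simp
    then show ?thesis
      unfolding m_def by linarith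
  qed
  define T where "T l = {cs. set cs \<subseteq> characters G \<and> length cs = m l}" for l
  define \<F> where "\<F> l = spectral_set G (1 / 2 ^ (l + 2)) ` T l" for l
  have card: "real (card (\<F> l)) \<le> exp (258 * 2 ^ (2 * l) * (ln (real n))\<^sup>2)" for l
  proof -
    have "card (\<F> l) \<le> card (T l)"
      unfolding \<F>_def T_def by (intro card_image_le finite_lists_length_eq finite_characters fin)
    also have "card (T l) = n ^ m l"
      unfolding T_def n_def
      by (simp add: card_lists_length_eq finite_characters fin card_characters)
    finally have "real (card (\<F> l)) \<le> real n ^ m l"
      by (metis of_nat_le_iff of_nat_power)
    also have "\<dots> = exp (real (m l) * ln (real n))"
      using n by (simp add: exp_of_nat_mult)
    also have "\<dots> \<le> exp (258 * 2 ^ (2 * l) * (ln (real n))\<^sup>2)"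
    proof -
      \<comment> \<open>Absorbs the extra factor n caused by rounding, so 256 becomes 258. For n
        \<ge> 2 it follows from ln 2 \<ge> 1/2; for n = 1 both sides are 0.\<close>
      have "ln (real n) \<le> 2 * (ln (real n))\<^sup>2"
      proof (cases "n = 1")
        case False
        then have "ln 2 \<le> ln (real n)"
          using n by simp
        moreover have "1 / 2 \<le> ln (2 :: real)"
          using exp_half_le2 by (subst ln_ge_iff) auto
        ultimately have "1 \<le> 2 * ln (real n)"
          by linarith
        from mult_right_mono[OF this ln_n] show ?thesis
          by (simp add: power2_eq_square)
      qed simp
      also have "\<dots> \<le> 2 * 2 ^ (2 * l) * (ln (real n))\<^sup>2"
        by (intro mult_right_mono) auto
      finally have "ln (real n) \<le> 2 * 2 ^ (2 * l) * (ln (real n))\<^sup>2" .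
      moreover have "real (m l) * ln (real n) \<le> (256 * 2 ^ (2 * l) * ln (real n) + 1) * ln (real n)"
        using m_le ln_n by (intro mult_right_mono)
      ultimately show ?thesis
        by (simp add: algebra_simps power2_eq_square)
    qed
    finally show ?thesis .
  qed
  have sub: "\<F> l \<subseteq> Pow (carrier G)" for l
    by (auto simp: \<F>_def spectral_set_def)
  have cover: "\<exists>F\<in>\<F> l. level_set G \<alpha> A l \<subseteq> F \<and> F \<subseteq> diff_set G A"
    if A: "A \<subseteq> carrier G" "A \<noteq> {}" "real (card A) = \<alpha> * real (order G)" for \<alpha> A l
  proof -
    obtain cs where cs: "set cs \<subseteq> characters G" "length cs = m l"
      "level_set G \<alpha> A l \<subseteq> spectral_set G (1 / 2 ^ (l + 2)) cs"
      "spectral_set G (1 / 2 ^ (l + 2)) cs \<subseteq> diff_set G A"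
      by (rule level_set_covered[OF fin A m_gt[of l, unfolded n_def]])
    then have "spectral_set G (1 / 2 ^ (l + 2)) cs \<in> \<F> l"
      by (auto simp: \<F>_def T_def)
    with cs show ?thesis
      by blast
  qed
  show thesis
    by (rule that[OF sub card[unfolded n_def] cover])
qed

end

text \<open>Levels range up to the ceiling of log_2 K, the range that the pigeonhole argument
  reaches. The constants are C = 258, from counting samples, and c = 1/6, from the
  pigeonhole.\<close>

theorem theorem2p3:
  "\<exists>C c :: real. C > 0 \<and> c > 0 \<and>
    (\<forall>(G :: 'a monoid) (n :: nat) (\<alpha> :: real).
      comm_group G \<longrightarrow> finite (carrier G) \<longrightarrow> order G = n \<longrightarrow> 0 < \<alpha> \<longrightarrow> \<alpha> < 1 \<longrightarrow>
      (\<exists>\<F> :: nat \<Rightarrow> 'a set set.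
        (\<forall>l. \<F> l \<subseteq> Pow (carrier G) \<and>
             real (card (\<F> l)) \<le> exp (C * 2 ^ (2 * l) * (ln (real n))\<^sup>2) \<and>
             (\<forall>F \<in> \<F> l. real (card F) \<ge> c * 2 ^ l * \<alpha> * real n / (real (max 1 l))\<^sup>2)) \<and>
        (\<forall>(K :: real) A.
          K \<ge> 1 \<longrightarrow> A \<subseteq> carrier G \<longrightarrow>
          real (card (diff_set G A)) \<le> K * real (card A) \<longrightarrow>
          real (card A) = \<alpha> * real n \<longrightarrow>
          (let large = (\<lambda>l. int l \<le> \<lceil>log 2 K\<rceil> \<and>
                 real (card (level_set G \<alpha> A l)) \<ge> c * 2 ^ l * \<alpha> * real n / (real (max 1 l))\<^sup>2)
           in (\<exists>l. large l) \<and>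
              (\<exists>F \<in> \<F> (LEAST l. large l). level_set G \<alpha> A (LEAST l. large l) \<subseteq> F \<and>
                 F \<subseteq> diff_set G A)))))"
proof -
  define b :: "real \<Rightarrow> nat \<Rightarrow> nat \<Rightarrow> real"
    where "b \<alpha> n l = 1 / 6 * 2 ^ l * \<alpha> * real n / (real (max 1 l))\<^sup>2" for \<alpha> n l
  have main: "\<exists>\<F> :: nat \<Rightarrow> 'a set set.
        (\<forall>l. \<F> l \<subseteq> Pow (carrier G) \<and>
             real (card (\<F> l)) \<le> exp (258 * 2 ^ (2 * l) * (ln (real n))\<^sup>2) \<and>
             (\<forall>F \<in> \<F> l. real (card F) \<ge> b \<alpha> n l)) \<and>
        (\<forall>(K :: real) A.
          K \<ge> 1 \<longrightarrow> A \<subseteq> carrier G \<longrightarrow>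
          real (card (diff_set G A)) \<le> K * real (card A) \<longrightarrow>
          real (card A) = \<alpha> * real n \<longrightarrow>
          (let large = (\<lambda>l. int l \<le> \<lceil>log 2 K\<rceil> \<and> real (card (level_set G \<alpha> A l)) \<ge> b \<alpha> n l)
           in (\<exists>l. large l) \<and>
              (\<exists>F \<in> \<F> (LEAST l. large l). level_set G \<alpha> A (LEAST l. large l) \<subseteq> F \<and>
                 F \<subseteq> diff_set G A)))"
    if "comm_group G" and fin: "finite (carrier G)" and n: "order G = n" and \<alpha>: "0 < \<alpha>"
    for G :: "'a monoid" and n \<alpha>
  proof -
    interpret comm_group G by fact
    obtain \<F> :: "nat \<Rightarrow> 'a set set" where sub: "\<And>l. \<F> l \<subseteq> Pow (carrier G)"
      and card: "\<And>l. real (card (\<F> l)) \<le> exp (258 * 2 ^ (2 * l) * (ln (real n))\<^sup>2)"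
      and cover: "\<And>\<alpha> A l. A \<subseteq> carrier G \<Longrightarrow> A \<noteq> {} \<Longrightarrow> real (card A) = \<alpha> * real n \<Longrightarrow>
        \<exists>F\<in>\<F> l. level_set G \<alpha> A l \<subseteq> F \<and> F \<subseteq> diff_set G A"
      using covering_family[OF fin] unfolding n by blast
    \<comment> \<open>Discarding small sets yields the lower bound on sizes and only shrinks the
      family. The covering set of a large level survives, since it contains that level set.\<close>
    define \<F>' where "\<F>' l = {F \<in> \<F> l. b \<alpha> n l \<le> real (card F)}" for l
    have finF: "finite (\<F> l)" for l
      using sub[of l] fin by (meson finite_Pow_iff finite_subset)
    have "n > 0"
      using fin n order_gt_0_iff_finite by blast
    have "\<F>' l \<subseteq> Pow (carrier G) \<and>
        real (card (\<F>' l)) \<le> exp (258 * 2 ^ (2 * l) * (ln (real n))\<^sup>2) \<and>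
        (\<forall>F \<in> \<F>' l. real (card F) \<ge> b \<alpha> n l)" for l
    proof -
      have "card (\<F>' l) \<le> card (\<F> l)"
        unfolding \<F>'_def by (intro card_mono finF) auto
      then show ?thesis
        using card[of l] sub[of l] by (auto simp: \<F>'_def)
    qed
    moreover have "(\<exists>l. large l) \<and>
        (\<exists>F \<in> \<F>' (LEAST l. large l). level_set G \<alpha> A (LEAST l. large l) \<subseteq> F \<and> F \<subseteq> diff_set G A)"
      if K: "K \<ge> 1" and A: "A \<subseteq> carrier G"
        and doubling: "real (card (diff_set G A)) \<le> K * real (card A)"
        and cardA: "real (card A) = \<alpha> * real n"
        and large: "large = (\<lambda>l. int l \<le> \<lceil>log 2 K\<rceil> \<and> real (card (level_set G \<alpha> A l)) \<ge> b \<alpha> n l)"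
      for K A large
    proof -
      have ne: "A \<noteq> {}"
        using cardA \<alpha> \<open>n > 0\<close> by auto
      have ex: "\<exists>l. large l"
        using popular_level_set[OF fin A ne _ K doubling, of \<alpha>] cardA unfolding large b_def n by blast
      define l where "l = (LEAST l. large l)"
      have l: "large l"
        unfolding l_def using ex by (rule LeastI_ex)
      obtain F where F: "F \<in> \<F> l" "level_set G \<alpha> A l \<subseteq> F" "F \<subseteq> diff_set G A"
        using cover[OF A ne cardA] by blast
      have "finite F"
        using F(1) sub[of l] fin by (auto intro: finite_subset)
      then have "card (level_set G \<alpha> A l) \<le> card F"
        using F(2) by (intro card_mono)
      then have "F \<in> \<F>' l"
        using l F(1) unfolding large \<F>'_def by auto
      then show ?thesis
        using ex F unfolding l_def by blast
    qed
    ultimately show ?thesis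
      unfolding Let_def by (intro exI[of _ \<F>']) blast
  qed
  show ?thesis
    using main unfolding b_def
    by (intro exI[of _ "258 :: real"] exI[of _ "1 / 6 :: real"]) simp
qed

end
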